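(* The following hold for the multiplications $\diamond$, $\circ$, $\bullet$ on the space $\mathit{Diff}_n$ of differential operators in $n$ variables. (1) The multiplication $\diamond$ is associative: for any $X,Y,Z\in \mathit{Diff}_n$, $X\diamond(Y\diamond Z)=(X\diamond Y)\diamond Z$. (2) The multiplication $\bullet$ is associative and commutative: for any $X,Y,Z\in \mathit{Diff}_n$, $X\bullet (Y\bullet Z)=(X\bullet Y)\bullet Z$ and $X\bullet Y=Y\bullet X$. (3) For any $X\in \mathit{Vect}(n)$ and $Y,Z\in \mathit{Diff}_n$, $$(X,Y,Z)^\circ =(X\bullet Y)\circ Z,\qquad X\circ (Y\bullet Z)=(X\circ Y)\bullet Z+Y\bullet (X\circ Z),$$ where $(X,Y,Z)^\circ =X\circ(Y\circ Z)-(X\circ Y)\circ Z$ is the associator of the multiplication $\circ$. (4) For any $X,Y\in \mathit{Vect}(n)$ and $Z\in \mathit{Diff}_n$, $(X,Y,Z)^\circ =(Y,X,Z)^\circ$.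
   Context: Let $U$ be the coefficient algebra: a commutative associative unital $\mathbf{C}$-algebra of functions $u=u(x_1,\ldots,x_n)$ with the commuting $\mathbf{C}$-linear derivations $\partial_i=\partial/\partial x_i$, $i=1,\dots,n$ (only this differential-algebra structure is used; for example $U=\mathbf{C}[[x_1,\ldots,x_n]]$). For $\alpha=(\alpha_1,\dots,\alpha_n)\in\mathbf{Z}_0^n$ ($\mathbf{Z}_0$ = non-negative integers) put $\partial^\alpha=\prod_{i=1}^n\partial_i^{\alpha_i}$. $\mathit{Diff}_n$ is the space of differential operators, i.e. finite formal sums $\sum_{\alpha\in\mathbf{Z}_0^n}u_\alpha\partial^\alpha$ with $u_\alpha\in U$ (the free $U$-module on the symbols $\partial^\alpha$). $\mathit{Vect}(n)$ is the subspace of differential operators of first order, i.e. those of the form $\sum_{i=1}^n u_i\partial_i$ with $u_i\in U$. Three bilinear multiplications on $\mathit{Diff}_n$ are defined on generators by $$u\partial^\alpha \diamond v \partial^\beta=\sum_{\gamma\in \mathbf{Z}^n_0} \binom{\alpha}{\gamma} u\,\partial^\gamma(v)\,\partial^{\alpha+\beta-\gamma},\qquad u\partial^\alpha\circ v\partial^\beta=u\,\partial^\alpha(v)\,\partial^\beta,\qquad u\partial^\alpha \bullet v\partial^\beta= u v\, \partial^{\alpha+\beta},$$ where $\binom{\alpha}{\gamma}=\prod_i\binom{\alpha_i}{\gamma_i}$ (zero unless $\gamma\le\alpha$ componentwise) and $\partial^\alpha(v)$ is the iterated derivative of $v$. *)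

theory Defs
  imports Complex_Main "HOL-Library.Poly_Mapping" "HOL-Analysis.Finite_Cartesian_Product"
begin

text \<open>
  A commutative unital complex algebra with commuting complex-linear derivations
  \<open>D i\<close>. The finite index type \<open>'n\<close> plays the role of \<open>{1, \<dots>, n}\<close>.
\<close>

locale diff_algebra = vector_space scale
  for scale :: "complex \<Rightarrow> 'u::comm_ring_1 \<Rightarrow> 'u" +
  fixes D :: "'n::finite \<Rightarrow> 'u \<Rightarrow> 'u"
  assumes scale_mult: "scale c (u * v) = scale c u * v"
    and D_linear: "Vector_Spaces.linear scale scale (D i)"
    and D_mult: "D i (u * v) = D i u * v + u * D i v"
    and D_commute: "D i (D j u) = D j (D i u)"

text \<open>
  The operator \<open>\<Prod>\<^sub>i D i ^^ \<alpha>\<^sub>i\<close>. The fold does not depend on an order of the indices only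
  because the maps \<open>D i\<close> commute.
\<close>

definition iter_deriv :: "('n::finite \<Rightarrow> 'u \<Rightarrow> 'u) \<Rightarrow> nat ^ 'n \<Rightarrow> 'u \<Rightarrow> 'u" where
  "iter_deriv D \<alpha> v = Finite_Set.fold (\<lambda>i. D i ^^ (\<alpha> $ i)) v UNIV"

text \<open>
  The free module on the symbols \<open>\<partial>\<^sup>\<alpha>\<close>: \<open>Poly_Mapping.single \<alpha> u\<close> is \<open>u \<partial>\<^sup>\<alpha>\<close>.
\<close>

type_synonym ('n, 'u) diff_op = "(nat ^ 'n) \<Rightarrow>\<^sub>0 'u"

definition Vect :: "('n::finite, 'u::comm_ring_1) diff_op set" where
  "Vect = range (\<lambda>u. \<Sum>i\<in>UNIV. Poly_Mapping.single (axis i 1) (u i))"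

definition multi_binomial :: "nat ^ 'n \<Rightarrow> nat ^ 'n::finite \<Rightarrow> nat" where
  "multi_binomial \<alpha> \<gamma> = (\<Prod>i\<in>UNIV. (\<alpha> $ i) choose (\<gamma> $ i))"

text \<open>
  Extension of a product \<open>m \<alpha> u \<beta> v\<close> of generators \<open>u \<partial>\<^sup>\<alpha>\<close> and \<open>v \<partial>\<^sup>\<beta>\<close> to all operators;
  \<open>m\<close> is meant to be additive in \<open>u\<close> and in \<open>v\<close>.
\<close>

definition bilinear_extension ::
  "(nat ^ 'n \<Rightarrow> 'u \<Rightarrow> nat ^ 'n \<Rightarrow> 'u \<Rightarrow> ('n::finite, 'u::comm_ring_1) diff_op) \<Rightarrow>
     ('n, 'u) diff_op \<Rightarrow> ('n, 'u) diff_op \<Rightarrow> ('n, 'u) diff_op" where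
  "bilinear_extension m X Y =
     (\<Sum>\<alpha>\<in>Poly_Mapping.keys X. \<Sum>\<beta>\<in>Poly_Mapping.keys Y.
        m \<alpha> (Poly_Mapping.lookup X \<alpha>) \<beta> (Poly_Mapping.lookup Y \<beta>))"

text \<open>
  The terms with \<open>\<gamma> \<le> \<alpha>\<close> are the only ones with nonzero binomial coefficient, and for them
  the truncated subtraction in \<open>\<alpha> + \<beta> - \<gamma>\<close> is exact.
\<close>

definition diamond :: "('n::finite \<Rightarrow> 'u::comm_ring_1 \<Rightarrow> 'u) \<Rightarrow>
    ('n, 'u) diff_op \<Rightarrow> ('n, 'u) diff_op \<Rightarrow> ('n, 'u) diff_op" where
  "diamond D = bilinear_extension (\<lambda>\<alpha> u \<beta> v. \<Sum>\<gamma> | \<forall>i. \<gamma> $ i \<le> \<alpha> $ i.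
     Poly_Mapping.single (\<alpha> + \<beta> - \<gamma>) (of_nat (multi_binomial \<alpha> \<gamma>) * u * iter_deriv D \<gamma> v))"

definition circ :: "('n::finite \<Rightarrow> 'u::comm_ring_1 \<Rightarrow> 'u) \<Rightarrow>
    ('n, 'u) diff_op \<Rightarrow> ('n, 'u) diff_op \<Rightarrow> ('n, 'u) diff_op" where
  "circ D = bilinear_extension (\<lambda>\<alpha> u \<beta> v. Poly_Mapping.single \<beta> (u * iter_deriv D \<alpha> v))"

definition bullet :: "('n::finite, 'u::comm_ring_1) diff_op \<Rightarrow> ('n, 'u) diff_op \<Rightarrow> ('n, 'u) diff_op"
  where "bullet = bilinear_extension (\<lambda>\<alpha> u \<beta> v. Poly_Mapping.single (\<alpha> + \<beta>) (u * v))"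

definition associator :: "('a \<Rightarrow> 'a \<Rightarrow> 'a) \<Rightarrow> 'a \<Rightarrow> 'a \<Rightarrow> 'a \<Rightarrow> 'a::minus" where
  "associator m X Y Z = m X (m Y Z) - m (m X Y) Z"

end

theory Submission
  imports Defs
begin

text \<open>
  Write \<open>U\<close> for the coefficient algebra. As a module, the space of operators is the commutative
  polynomial ring \<open>U[\<partial>\<^sub>1, \<dots>, \<partial>\<^sub>n]\<close>, and \<open>\<bullet>\<close> is its product (\<open>bullet_eq_times\<close>). The other two products
  come from one construction: commuting additive maps \<open>Q\<^sub>i\<close> on this ring can be substituted for the
  \<open>\<partial>\<^sub>i\<close> in an operator \<open>X = \<Sum> u\<^sub>\<alpha> \<partial>\<^sup>\<alpha>\<close>, which gives the map \<open>Z \<mapsto> \<Sum> u\<^sub>\<alpha> Q\<^sup>\<alpha> Z\<close>. Let \<open>A\<^sub>i\<close> apply \<open>D i\<close> to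
  each coefficient, and let \<open>P\<^sub>i = A\<^sub>i + \<partial>\<^sub>i \<bullet> _\<close>. Then \<open>\<circ>\<close> substitutes \<open>A\<close> (\<open>circ_eq_op_apply\<close>), and \<open>\<diamond>\<close>
  substitutes \<open>P\<close> (\<open>diamond_eq_op_apply\<close>). The latter is the Leibniz rule, which follows from Pascal's
  rule by induction on the multi-index (\<open>iter_full_deriv_single\<close>).

  Both \<open>Q = A\<close> and \<open>Q = P\<close> satisfy \<open>Q\<^sub>i (v Z) = D\<^sub>i(v) Z + v Q\<^sub>i Z\<close> for \<open>v \<in> U\<close>. Hence
  \<open>(P\<^sub>i W) \<diamond> Z = P\<^sub>i (W \<diamond> Z)\<close>, because for \<open>W = v \<partial>\<^sup>\<beta>\<close> both sides are \<open>D\<^sub>i(v) P\<^sup>\<beta> Z + v P\<^sub>i P\<^sup>\<beta> Z\<close>.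
  By iteration \<open>(u P\<^sup>\<alpha> W) \<diamond> Z = u P\<^sup>\<alpha> (W \<diamond> Z)\<close>, which is the associativity of \<open>\<diamond>\<close>. The same
  computation with \<open>A\<close> gives \<open>X \<circ> (Y \<circ> Z) = (X \<circ> Y) \<circ> Z + (X \<bullet> Y) \<circ> Z\<close> for \<open>X = u \<partial>\<^sub>i\<close>, and
  \<open>X \<circ> _ = u A\<^sub>i\<close> is a derivation of the polynomial ring because \<open>A\<^sub>i\<close> is one. The left symmetry of
  the associator on vector fields then follows from the commutativity of \<open>\<bullet>\<close>.
\<close>

section \<open>Multi-indices and iterated maps\<close>

lemma multi_index_induct [case_names zero plus_axis]:
  fixes \<alpha> :: "nat ^ 'n::finite"
  assumes zero: "P 0"
    and plus_axis: "\<And>\<alpha> i. P \<alpha> \<Longrightarrow> P (\<alpha> + axis i 1)"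
  shows "P \<alpha>"
proof (induction "\<Sum>i\<in>UNIV. \<alpha> $ i" arbitrary: \<alpha>)
  case 0
  then have "\<alpha> = 0"
    by (simp add: vec_eq_iff)
  with zero show ?case
    by simp
next
  case (Suc k)
  then obtain i where i: "\<alpha> $ i > 0"
    by (metis (mono_tags, lifting) gr0I sum.neutral nat.distinct(1))
  define \<beta> where "\<beta> = (\<chi> j. if j = i then \<alpha> $ j - 1 else \<alpha> $ j)"
  have \<alpha>: "\<alpha> = \<beta> + axis i 1"
    using i by (auto simp: vec_eq_iff \<beta>_def axis_def)
  have "(\<Sum>j\<in>UNIV. \<alpha> $ j) = Suc (\<Sum>j\<in>UNIV. \<beta> $ j)"
    by (simp add: \<alpha> sum.distrib axis_def)
  with Suc have "P \<beta>"
    by simp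
  then show ?case
    unfolding \<alpha> by (rule plus_axis)
qed

lemma finite_multi_index_atMost: "finite {\<gamma> :: nat ^ 'n::finite. \<forall>i. \<gamma> $ i \<le> \<alpha> $ i}"
proof (rule finite_subset)
  show "{\<gamma>. \<forall>i. \<gamma> $ i \<le> \<alpha> $ i} \<subseteq> vec_lambda ` (\<Pi>\<^sub>E i\<in>UNIV. {..\<alpha> $ i})"
    by (auto intro!: image_eqI[where x = "vec_nth _"])
  show "finite (vec_lambda ` (\<Pi>\<^sub>E i\<in>UNIV. {..\<alpha> $ i}) :: (nat ^ 'n) set)"
    by (intro finite_imageI finite_PiE) auto
qed

text \<open>
  A finite family of commuting additive maps. Its iterates \<open>Q\<^sup>\<alpha>\<close> are written \<open>iter_deriv Q \<alpha>\<close>, both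
  for the derivations of the coefficients and for maps on operators.
\<close>

locale commuting_additive_maps =
  fixes Q :: "'n::finite \<Rightarrow> 'a::ab_group_add \<Rightarrow> 'a"
  assumes Q_commute: "Q i (Q j x) = Q j (Q i x)"
    and Q_add: "Q i (x + y) = Q i x + Q i y"
begin

lemma comp_fun_commute_Q_funpow: "comp_fun_commute (\<lambda>i. Q i ^^ a i)"
proof -
  interpret comp_fun_commute Q
    by standard (simp add: fun_eq_iff Q_commute)
  show ?thesis
    by (rule comp_fun_commute_funpow)
qed

lemma iter_deriv_0 [simp]: "iter_deriv Q 0 = id"
proof
  fix v
  define f where "f = (\<lambda>i. Q i ^^ (0 $ i))"
  interpret comp_fun_commute f
    unfolding f_def by (rule comp_fun_commute_Q_funpow)
  have "Finite_Set.fold f v S = v" if "finite S" for S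
    using that by induction (simp_all, simp add: f_def)
  then show "iter_deriv Q 0 v = id v"
    by (simp add: iter_deriv_def f_def)
qed

lemma iter_deriv_plus_axis: "iter_deriv Q (\<alpha> + axis i 1) v = Q i (iter_deriv Q \<alpha> v)"
proof -
  define f where "f = (\<lambda>j. Q j ^^ ((\<alpha> + axis i 1) $ j))"
  define g where "g = (\<lambda>j. Q j ^^ (\<alpha> $ j))"
  have commute: "comp_fun_commute_on UNIV f" "comp_fun_commute_on UNIV g"
    unfolding f_def g_def comp_fun_commute_def'[symmetric]
    by (rule comp_fun_commute_Q_funpow)+
  interpret f: comp_fun_commute_on UNIV f by (rule commute)
  interpret g: comp_fun_commute_on UNIV g by (rule commute)
  have "Finite_Set.fold f v UNIV = f i (Finite_Set.fold f v (UNIV - {i}))"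
    by (rule f.fold_rec) auto
  also have "f i = Q i \<circ> g i"
    by (simp add: f_def g_def axis_def)
  also have "Finite_Set.fold f v (UNIV - {i}) = Finite_Set.fold g v (UNIV - {i})"
    using commute by (rule Finite_Set.fold_cong) (auto simp: f_def g_def axis_def)
  also have "(Q i \<circ> g i) \<dots> = Q i (Finite_Set.fold g v UNIV)"
    by (simp add: g.fold_rec[of UNIV i])
  finally show ?thesis
    by (simp add: iter_deriv_def f_def g_def)
qed

lemma iter_deriv_axis: "iter_deriv Q (axis i 1) = Q i"
  using iter_deriv_plus_axis[of 0 i] by (simp add: fun_eq_iff)

text \<open>
  The simplifier would rewrite \<open>axis i 1\<close> to \<open>axis i (Suc 0)\<close>, so \<open>One_nat_def\<close> is removed wherever
  a rule about \<open>axis i 1\<close> has to match.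
\<close>

lemma iter_deriv_add: "iter_deriv Q \<alpha> (x + y) = iter_deriv Q \<alpha> x + iter_deriv Q \<alpha> y"
  by (induction \<alpha> rule: multi_index_induct)
    (simp_all add: iter_deriv_plus_axis Q_add del: One_nat_def)

end

section \<open>Pascal's rule for multi-indices\<close>

lemma multi_binomial_eq_0:
  fixes \<alpha> :: "nat ^ 'n::finite"
  assumes "\<not> (\<forall>i. \<gamma> $ i \<le> \<alpha> $ i)"
  shows "multi_binomial \<alpha> \<gamma> = 0"
  using assms unfolding multi_binomial_def by (auto simp: not_le)

lemma multi_binomial_plus_axis:
  fixes \<alpha> :: "nat ^ 'n::finite"
  shows
  "multi_binomial (\<alpha> + axis i 1) \<gamma> =
   multi_binomial \<alpha> \<gamma> + (if \<gamma> $ i = 0 then 0 else multi_binomial \<alpha> (\<gamma> - axis i 1))"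
proof -
  have split: "multi_binomial \<beta> \<delta> =
      (\<beta> $ i choose \<delta> $ i) * (\<Prod>j\<in>UNIV - {i}. \<beta> $ j choose \<delta> $ j)" for \<beta> \<delta> :: "nat ^ 'n"
    unfolding multi_binomial_def by (rule prod.remove) auto
  define R where "R = (\<Prod>j\<in>UNIV - {i}. \<alpha> $ j choose \<gamma> $ j)"
  have R: "(\<Prod>j\<in>UNIV - {i}. (\<alpha> + axis i 1) $ j choose \<gamma> $ j) = R"
       "(\<Prod>j\<in>UNIV - {i}. \<alpha> $ j choose (\<gamma> - axis i 1) $ j) = R"
    unfolding R_def by (auto intro!: prod.cong simp: axis_def)
  show ?thesis
    unfolding split R R_def[symmetric]
    by (cases "\<gamma> $ i") (simp_all add: axis_def distrib_right)
qed

text \<open>Pascal's rule for a sum over all \<open>\<gamma> \<le> \<alpha> + e\<^sub>i\<close>; \<open>\<delta>\<close> in \<open>G \<gamma> \<delta>\<close> is the complement of \<open>\<gamma>\<close>.\<close>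

lemma multi_binomial_sum_plus_axis:
  fixes G :: "nat ^ 'n::finite \<Rightarrow> nat ^ 'n \<Rightarrow> 'r::comm_ring_1" and \<alpha> :: "nat ^ 'n"
  shows "(\<Sum>\<gamma> | \<forall>j. \<gamma> $ j \<le> (\<alpha> + axis i 1) $ j.
            of_nat (multi_binomial (\<alpha> + axis i 1) \<gamma>) * G \<gamma> (\<alpha> + axis i 1 - \<gamma>)) =
         (\<Sum>\<gamma> | \<forall>j. \<gamma> $ j \<le> \<alpha> $ j. of_nat (multi_binomial \<alpha> \<gamma>) *
            (G (\<gamma> + axis i 1) (\<alpha> - \<gamma>) + G \<gamma> (\<alpha> - \<gamma> + axis i 1)))"
    (is "(\<Sum>\<gamma> | _. of_nat (multi_binomial ?\<alpha> \<gamma>) * _) = _")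
proof -
  let ?e = "axis i 1 :: nat ^ 'n"
  define L where "L \<alpha> = {\<gamma> :: nat ^ 'n. \<forall>j. \<gamma> $ j \<le> \<alpha> $ j}" for \<alpha>
  have fin: "finite (L \<alpha>)" for \<alpha>
    unfolding L_def by (rule finite_multi_index_atMost)
  have le: "\<gamma> $ j \<le> ?\<alpha> $ j" if "\<gamma> \<in> L \<alpha>" for \<gamma> j
    using that le_trans[of "\<gamma> $ j" "\<alpha> $ j" "?\<alpha> $ j"] by (simp add: L_def)
  have sub: "L \<alpha> \<subseteq> L ?\<alpha>"
    using le by (auto simp: L_def)
  have "(\<Sum>\<gamma>\<in>L ?\<alpha>. of_nat (multi_binomial ?\<alpha> \<gamma>) * G \<gamma> (?\<alpha> - \<gamma>)) =
        (\<Sum>\<gamma>\<in>L ?\<alpha>. of_nat (multi_binomial \<alpha> \<gamma>) * G \<gamma> (?\<alpha> - \<gamma>)) +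
        (\<Sum>\<gamma>\<in>L ?\<alpha>. if \<gamma> $ i = 0 then 0
            else of_nat (multi_binomial \<alpha> (\<gamma> - ?e)) * G \<gamma> (?\<alpha> - \<gamma>))"
    unfolding sum.distrib[symmetric]
    by (intro sum.cong) (auto simp: multi_binomial_plus_axis distrib_right simp del: One_nat_def)
  \<comment> \<open>the first binomial coefficient vanishes unless \<open>\<gamma> \<le> \<alpha>\<close>\<close>
  also have "(\<Sum>\<gamma>\<in>L ?\<alpha>. of_nat (multi_binomial \<alpha> \<gamma>) * G \<gamma> (?\<alpha> - \<gamma>)) =
             (\<Sum>\<gamma>\<in>L \<alpha>. of_nat (multi_binomial \<alpha> \<gamma>) * G \<gamma> (?\<alpha> - \<gamma>))"
    by (intro sum.mono_neutral_right fin sub) (auto simp: L_def multi_binomial_eq_0)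
  also have "\<dots> = (\<Sum>\<gamma>\<in>L \<alpha>. of_nat (multi_binomial \<alpha> \<gamma>) * G \<gamma> (\<alpha> - \<gamma> + ?e))"
  proof (rule sum.cong)
    fix \<gamma> assume "\<gamma> \<in> L \<alpha>"
    then have "?\<alpha> - \<gamma> = \<alpha> - \<gamma> + ?e"
      by (simp add: L_def vec_eq_iff)
    then show "of_nat (multi_binomial \<alpha> \<gamma>) * G \<gamma> (?\<alpha> - \<gamma>) =
               of_nat (multi_binomial \<alpha> \<gamma>) * G \<gamma> (\<alpha> - \<gamma> + ?e)"
      by (simp only:)
  qed simp
  \<comment> \<open>the second sum is reindexed by \<open>\<gamma> \<mapsto> \<gamma> - e\<^sub>i\<close>, a bijection from \<open>{\<gamma> \<le> \<alpha> + e\<^sub>i. \<gamma>\<^sub>i \<noteq> 0}\<close> onto \<open>{\<gamma> \<le> \<alpha>}\<close>\<close>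
  also have "(\<Sum>\<gamma>\<in>L ?\<alpha>. if \<gamma> $ i = 0 then 0
                else of_nat (multi_binomial \<alpha> (\<gamma> - ?e)) * G \<gamma> (?\<alpha> - \<gamma>)) =
             (\<Sum>\<gamma>\<in>{\<gamma> \<in> L ?\<alpha>. \<gamma> $ i \<noteq> 0}.
                of_nat (multi_binomial \<alpha> (\<gamma> - ?e)) * G \<gamma> (?\<alpha> - \<gamma>))"
    using fin by (intro sum.mono_neutral_cong_right) auto
  also have "\<dots> = (\<Sum>\<gamma>\<in>L \<alpha>. of_nat (multi_binomial \<alpha> \<gamma>) * G (\<gamma> + ?e) (\<alpha> - \<gamma>))"
  proof (rule sum.reindex_bij_witness[of _ "\<lambda>\<gamma>. \<gamma> + ?e" "\<lambda>\<gamma>. \<gamma> - ?e"])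
    fix \<gamma> assume \<gamma>: "\<gamma> \<in> {\<gamma> \<in> L ?\<alpha>. \<gamma> $ i \<noteq> 0}"
    show eq: "\<gamma> - ?e + ?e = \<gamma>"
      using \<gamma> by (auto simp: vec_eq_iff axis_def)
    show "\<gamma> - ?e \<in> L \<alpha>"
      using \<gamma> by (auto simp: L_def le_diff_conv)
    have "?\<alpha> - \<gamma> = \<alpha> - (\<gamma> - ?e)"
      using \<gamma> by (auto simp: vec_eq_iff axis_def)
    with eq show "of_nat (multi_binomial \<alpha> (\<gamma> - ?e)) * G (\<gamma> - ?e + ?e) (\<alpha> - (\<gamma> - ?e)) =
          of_nat (multi_binomial \<alpha> (\<gamma> - ?e)) * G \<gamma> (?\<alpha> - \<gamma>)"
      by (simp only:)
  qed (auto simp: L_def vec_eq_iff axis_def)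
  finally show ?thesis
    unfolding L_def by (simp only: distrib_left sum.distrib add.commute)
qed

section \<open>Additive extension from generators\<close>

lemma poly_mapping_additive_induct [case_names zero single add]:
  assumes zero: "P 0"
    and single: "\<And>\<alpha> u. P (Poly_Mapping.single \<alpha> u)"
    and add: "\<And>X Y. P X \<Longrightarrow> P Y \<Longrightarrow> P (X + Y)"
  shows "P (X :: 'a \<Rightarrow>\<^sub>0 'b::comm_monoid_add)"
proof (induction X rule: update_induct)
  case const
  show ?case by (rule zero)
next
  case (update X \<alpha> u)
  have "Poly_Mapping.update \<alpha> u X = X + Poly_Mapping.single \<alpha> u"
    using update(1)
    by (intro poly_mapping_eqI) (auto simp: lookup_update lookup_add lookup_single in_keys_iff)
  then show ?case
    using add[OF update(3) single] by simp
qed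

lemma additive_on_sums_ext:
  fixes f g :: "('a \<Rightarrow>\<^sub>0 'b::comm_monoid_add) \<Rightarrow> 'c::ab_group_add"
  assumes "\<And>X Y. f (X + Y) = f X + f Y" "\<And>X Y. g (X + Y) = g X + g Y"
    and "\<And>\<alpha> u. f (Poly_Mapping.single \<alpha> u) = g (Poly_Mapping.single \<alpha> u)"
  shows "f X = g X"
proof (induction X rule: poly_mapping_additive_induct)
  case zero
  show ?case
    using assms(3)[of undefined 0] by simp
qed (simp_all add: assms)

lemma biadditive_ext:
  fixes f g :: "('a \<Rightarrow>\<^sub>0 'b::comm_monoid_add) \<Rightarrow> ('c \<Rightarrow>\<^sub>0 'd::comm_monoid_add) \<Rightarrow> 'e::ab_group_add"
  assumes f: "\<And>X X' Y. f (X + X') Y = f X Y + f X' Y" "\<And>X Y Y'. f X (Y + Y') = f X Y + f X Y'"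
    and g: "\<And>X X' Y. g (X + X') Y = g X Y + g X' Y" "\<And>X Y Y'. g X (Y + Y') = g X Y + g X Y'"
    and eq: "\<And>\<alpha> u \<beta> v. f (Poly_Mapping.single \<alpha> u) (Poly_Mapping.single \<beta> v) =
                g (Poly_Mapping.single \<alpha> u) (Poly_Mapping.single \<beta> v)"
  shows "f X Y = g X Y"
proof -
  have "f (Poly_Mapping.single \<alpha> u) Y = g (Poly_Mapping.single \<alpha> u) Y" for \<alpha> u
    by (rule additive_on_sums_ext) (simp_all add: f g eq)
  with f(1) g(1) show ?thesis
    by (rule additive_on_sums_ext[of "\<lambda>X. f X Y" "\<lambda>X. g X Y"])
qed

lemma sum_keys_add:
  fixes h :: "'a \<Rightarrow> 'b::comm_monoid_add \<Rightarrow> 'c::ab_group_add"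
  assumes "\<And>\<alpha> u v. h \<alpha> (u + v) = h \<alpha> u + h \<alpha> v"
  shows "(\<Sum>\<alpha>\<in>Poly_Mapping.keys (X + Y). h \<alpha> (Poly_Mapping.lookup (X + Y) \<alpha>)) =
         (\<Sum>\<alpha>\<in>Poly_Mapping.keys X. h \<alpha> (Poly_Mapping.lookup X \<alpha>)) +
         (\<Sum>\<alpha>\<in>Poly_Mapping.keys Y. h \<alpha> (Poly_Mapping.lookup Y \<alpha>))"
proof -
  define K where "K = Poly_Mapping.keys X \<union> Poly_Mapping.keys Y"
  have zero: "h \<alpha> 0 = 0" for \<alpha>
    using assms[of \<alpha> 0 0] by simp
  have *: "(\<Sum>\<alpha>\<in>Poly_Mapping.keys W. h \<alpha> (Poly_Mapping.lookup W \<alpha>)) =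
           (\<Sum>\<alpha>\<in>K. h \<alpha> (Poly_Mapping.lookup W \<alpha>))" if "Poly_Mapping.keys W \<subseteq> K" for W
    using that by (intro sum.mono_neutral_left) (auto simp: K_def in_keys_iff zero)
  show ?thesis
    using keys_add[of X Y]
    by (subst (1 2 3) *) (auto simp: K_def lookup_add assms sum.distrib)
qed

lemma sum_keys_single:
  fixes h :: "'a \<Rightarrow> 'b::zero \<Rightarrow> 'c::comm_monoid_add"
  assumes "h \<alpha> 0 = 0"
  shows "(\<Sum>\<beta>\<in>Poly_Mapping.keys (Poly_Mapping.single \<alpha> u).
            h \<beta> (Poly_Mapping.lookup (Poly_Mapping.single \<alpha> u) \<beta>)) = h \<alpha> u"
  using assms by auto

context
  fixes m :: "nat ^ 'n \<Rightarrow> 'u \<Rightarrow> nat ^ 'n \<Rightarrow> 'u \<Rightarrow> ('n::finite, 'u::comm_ring_1) diff_op"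
  assumes add_left: "\<And>\<alpha> u u' \<beta> v. m \<alpha> (u + u') \<beta> v = m \<alpha> u \<beta> v + m \<alpha> u' \<beta> v"
    and add_right: "\<And>\<alpha> u \<beta> v v'. m \<alpha> u \<beta> (v + v') = m \<alpha> u \<beta> v + m \<alpha> u \<beta> v'"
begin

lemma bilinear_extension_add_left:
  "bilinear_extension m (X + X') Y = bilinear_extension m X Y + bilinear_extension m X' Y"
  unfolding bilinear_extension_def
  by (rule sum_keys_add) (simp add: add_left sum.distrib)

lemma bilinear_extension_add_right:
  "bilinear_extension m X (Y + Y') = bilinear_extension m X Y + bilinear_extension m X Y'"
  unfolding bilinear_extension_def
  by (simp add: sum_keys_add[where h = "m _ _"] add_right sum.distrib)

lemma bilinear_extension_single:
  "bilinear_extension m (Poly_Mapping.single \<alpha> u) (Poly_Mapping.single \<beta> v) = m \<alpha> u \<beta> v"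
proof -
  have "m \<alpha> 0 \<beta> v = 0" "m \<alpha> u \<beta> 0 = 0" for \<alpha> u \<beta> v
    using add_left[of \<alpha> 0 0 \<beta> v] add_right[of \<alpha> u \<beta> 0 0] by simp_all
  then show ?thesis
    unfolding bilinear_extension_def by (simp add: sum_keys_single[where h = "m _ _"])
qed

end

section \<open>The commutative product\<close>

lemma bullet_eq_times: "bullet X Y = X * (Y :: ('n::finite, 'u::comm_ring_1) diff_op)"
proof (rule biadditive_ext[where X = X and Y = Y])
  fix \<alpha> \<beta> :: "nat ^ 'n" and u v :: 'u
  show "bullet (Poly_Mapping.single \<alpha> u) (Poly_Mapping.single \<beta> v) =
        Poly_Mapping.single \<alpha> u * Poly_Mapping.single \<beta> v"
    unfolding bullet_def
    by (subst bilinear_extension_single) (simp_all add: mult_single single_add algebra_simps)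
qed (auto simp: bullet_def bilinear_extension_add_left bilinear_extension_add_right
      single_add algebra_simps)

section \<open>Substituting commuting maps into an operator\<close>

text \<open>
  The value at \<open>Z\<close> of \<open>\<Sum> u\<^sub>\<alpha> Q\<^sup>\<alpha>\<close>, where \<open>X = \<Sum> u\<^sub>\<alpha> \<partial>\<^sup>\<alpha>\<close>. The coefficient \<open>u\<^sub>\<alpha>\<close> acts by multiplication
  with the constant polynomial \<open>Poly_Mapping.single 0 u\<^sub>\<alpha>\<close>.
\<close>

definition op_apply :: "('n \<Rightarrow> ('n, 'u) diff_op \<Rightarrow> ('n, 'u) diff_op) \<Rightarrow>
    ('n::finite, 'u::comm_ring_1) diff_op \<Rightarrow> ('n, 'u) diff_op \<Rightarrow> ('n, 'u) diff_op" where
  "op_apply Q X Z = (\<Sum>\<alpha>\<in>Poly_Mapping.keys X.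
     Poly_Mapping.single 0 (Poly_Mapping.lookup X \<alpha>) * iter_deriv Q \<alpha> Z)"

lemma op_apply_add_left: "op_apply Q (X + Y) Z = op_apply Q X Z + op_apply Q Y Z"
  unfolding op_apply_def by (rule sum_keys_add) (simp add: single_add distrib_right)

lemma op_apply_single:
  "op_apply Q (Poly_Mapping.single \<alpha> u) Z = Poly_Mapping.single 0 u * iter_deriv Q \<alpha> Z"
  by (simp add: op_apply_def)

lemma op_apply_mult_const:
  "op_apply Q (Poly_Mapping.single 0 u * W) Z = Poly_Mapping.single 0 u * op_apply Q W Z"
proof (rule additive_on_sums_ext[where X = W])
  fix \<beta> v
  show "op_apply Q (Poly_Mapping.single 0 u * Poly_Mapping.single \<beta> v) Z =
        Poly_Mapping.single 0 u * op_apply Q (Poly_Mapping.single \<beta> v) Z"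
    by (simp add: mult_single op_apply_single mult.assoc[symmetric])
qed (simp_all add: op_apply_add_left distrib_left)

lemma op_apply_add_right:
  assumes "commuting_additive_maps Q"
  shows "op_apply Q X (Y + Z) = op_apply Q X Y + op_apply Q X Z"
  unfolding op_apply_def
  by (simp add: commuting_additive_maps.iter_deriv_add[OF assms] distrib_left sum.distrib)

section \<open>Coefficientwise derivatives and operator composition\<close>

context diff_algebra
begin

lemma D_add: "D i (u + v) = D i u + D i v"
  using D_linear[of i] by (simp add: Vector_Spaces.linear_iff)

sublocale D: commuting_additive_maps D
  by standard (rule D_commute, rule D_add)

lemma D_zero [simp]: "D i 0 = 0"
  using D_add[of i 0 0] by simp

lemma D_one [simp]: "D i 1 = 0"
  using D_mult[of i 1 1] by simp

text \<open>The derivation \<open>u \<partial>\<^sup>\<alpha> \<mapsto> D\<^sub>i(u) \<partial>\<^sup>\<alpha>\<close> of the polynomial ring.\<close>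

definition coeff_deriv :: "'n \<Rightarrow> ('n, 'u) diff_op \<Rightarrow> ('n, 'u) diff_op" where
  "coeff_deriv i = Poly_Mapping.map (D i)"

text \<open>The composition \<open>\<partial>\<^sub>i \<diamond> _\<close>, which is \<open>u \<partial>\<^sup>\<alpha> \<mapsto> D\<^sub>i(u) \<partial>\<^sup>\<alpha> + u \<partial>\<^sub>i \<partial>\<^sup>\<alpha>\<close>.\<close>

definition full_deriv :: "'n \<Rightarrow> ('n, 'u) diff_op \<Rightarrow> ('n, 'u) diff_op" where
  "full_deriv i X = coeff_deriv i X + Poly_Mapping.single (axis i 1) 1 * X"

lemma lookup_coeff_deriv: "Poly_Mapping.lookup (coeff_deriv i X) \<alpha> = D i (Poly_Mapping.lookup X \<alpha>)"
  by (simp add: coeff_deriv_def map.rep_eq when_def)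

lemma coeff_deriv_single [simp]:
  "coeff_deriv i (Poly_Mapping.single \<alpha> u) = Poly_Mapping.single \<alpha> (D i u)"
  by (rule poly_mapping_eqI) (simp add: lookup_coeff_deriv lookup_single when_def)

lemma coeff_deriv_add: "coeff_deriv i (X + Y) = coeff_deriv i X + coeff_deriv i Y"
  by (rule poly_mapping_eqI) (simp add: lookup_coeff_deriv lookup_add D_add)

lemma coeff_deriv_mult: "coeff_deriv i (X * Y) = coeff_deriv i X * Y + X * coeff_deriv i Y"
  by (rule biadditive_ext[where X = X and Y = Y])
    (simp_all add: coeff_deriv_add mult_single D_mult single_add algebra_simps)

sublocale coeff: commuting_additive_maps coeff_deriv
  by standard
    (auto intro: poly_mapping_eqI simp: lookup_coeff_deriv coeff_deriv_add D_commute)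

lemma full_deriv_add: "full_deriv i (X + Y) = full_deriv i X + full_deriv i Y"
  by (simp add: full_deriv_def coeff_deriv_add distrib_left)

sublocale full: commuting_additive_maps full_deriv
proof
  \<comment> \<open>\<open>A\<^sub>i\<close> commutes with the multiplication by \<open>\<partial>\<^sub>j\<close>, whose coefficient \<open>1\<close> is killed by \<open>D i\<close>\<close>
  show "full_deriv i (full_deriv j X) = full_deriv j (full_deriv i X)" for i j X
    by (simp add: full_deriv_def coeff_deriv_add coeff_deriv_mult coeff.Q_commute[of i j]
        algebra_simps)
qed (rule full_deriv_add)

lemma full_deriv_single:
  "full_deriv i (Poly_Mapping.single \<alpha> u) =
   Poly_Mapping.single \<alpha> (D i u) + Poly_Mapping.single (\<alpha> + axis i 1) u"
  by (simp add: full_deriv_def mult_single add.commute)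

lemma full_deriv_mult_const:
  "full_deriv i (Poly_Mapping.single 0 u * Z) =
   Poly_Mapping.single 0 (D i u) * Z + Poly_Mapping.single 0 u * full_deriv i Z"
  by (simp add: full_deriv_def coeff_deriv_mult algebra_simps)

lemma iter_coeff_deriv_single:
  "iter_deriv coeff_deriv \<alpha> (Poly_Mapping.single \<beta> v) = Poly_Mapping.single \<beta> (iter_deriv D \<alpha> v)"
  by (induction \<alpha> rule: multi_index_induct)
    (simp_all add: coeff.iter_deriv_plus_axis D.iter_deriv_plus_axis del: One_nat_def)

lemma circ_eq_op_apply: "circ D X Y = op_apply coeff_deriv X Y"
proof (rule biadditive_ext[where X = X and Y = Y])
  fix \<alpha> u \<beta> v
  show "circ D (Poly_Mapping.single \<alpha> u) (Poly_Mapping.single \<beta> v) =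
        op_apply coeff_deriv (Poly_Mapping.single \<alpha> u) (Poly_Mapping.single \<beta> v)"
    unfolding circ_def
    by (subst bilinear_extension_single)
      (simp_all add: op_apply_single iter_coeff_deriv_single mult_single single_add
        D.iter_deriv_add algebra_simps)
qed (auto simp: circ_def bilinear_extension_add_left bilinear_extension_add_right
      op_apply_add_left op_apply_add_right coeff.commuting_additive_maps_axioms
      D.iter_deriv_add single_add algebra_simps)

section \<open>The Leibniz rule\<close>

text \<open>The left-hand side is \<open>\<partial>\<^sup>\<alpha> \<diamond> v \<partial>\<^sup>\<beta>\<close>.\<close>

lemma iter_full_deriv_single:
  "iter_deriv full_deriv \<alpha> (Poly_Mapping.single \<beta> v) =
   (\<Sum>\<gamma> | \<forall>i. \<gamma> $ i \<le> \<alpha> $ i. of_nat (multi_binomial \<alpha> \<gamma>) *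
      Poly_Mapping.single (\<alpha> - \<gamma> + \<beta>) (iter_deriv D \<gamma> v))"
proof (induction \<alpha> rule: multi_index_induct)
  case zero
  have "{\<gamma> :: nat ^ 'n. \<forall>i. \<gamma> $ i \<le> 0 $ i} = {0}"
    by (auto simp: vec_eq_iff)
  then show ?case
    by (simp add: multi_binomial_def)
next
  case (plus_axis \<alpha> i)
  interpret add: additive "full_deriv i"
    by standard (rule full_deriv_add)
  have of_nat: "full_deriv i (of_nat k * X) = of_nat k * full_deriv i X" for k X
    by (induction k) (simp_all add: add.zero full_deriv_add distrib_right)
  show ?case
    unfolding full.iter_deriv_plus_axis plus_axis.IH add.sum
      multi_binomial_sum_plus_axis[where
        G = "\<lambda>\<gamma> \<delta>. Poly_Mapping.single (\<delta> + \<beta>) (iter_deriv D \<gamma> v)"]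
    by (simp add: of_nat full_deriv_single D.iter_deriv_plus_axis ac_simps del: One_nat_def)
qed

text \<open>The left-hand side is the defining expression of \<open>u \<partial>\<^sup>\<alpha> \<diamond> v \<partial>\<^sup>\<beta>\<close>.\<close>

lemma diamond_generator:
  "(\<Sum>\<gamma> | \<forall>i. \<gamma> $ i \<le> \<alpha> $ i.
      Poly_Mapping.single (\<alpha> + \<beta> - \<gamma>) (of_nat (multi_binomial \<alpha> \<gamma>) * u * iter_deriv D \<gamma> v)) =
   Poly_Mapping.single 0 u * iter_deriv full_deriv \<alpha> (Poly_Mapping.single \<beta> v)"
  unfolding iter_full_deriv_single sum_distrib_left
proof (rule sum.cong)
  fix \<gamma> assume "\<gamma> \<in> {\<gamma>. \<forall>i. \<gamma> $ i \<le> \<alpha> $ i}"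
  then have exponent: "\<alpha> + \<beta> - \<gamma> = \<alpha> - \<gamma> + \<beta>"
    by (simp add: vec_eq_iff)
  have of_nat: "of_nat k * Poly_Mapping.single \<delta> w = Poly_Mapping.single \<delta> (of_nat k * w)"
    for k and \<delta> :: "nat ^ 'n" and w :: 'u
    by (simp only: single_of_nat[symmetric] mult_single add_0)
  show "Poly_Mapping.single (\<alpha> + \<beta> - \<gamma>) (of_nat (multi_binomial \<alpha> \<gamma>) * u * iter_deriv D \<gamma> v) =
      Poly_Mapping.single 0 u * (of_nat (multi_binomial \<alpha> \<gamma>) *
        Poly_Mapping.single (\<alpha> - \<gamma> + \<beta>) (iter_deriv D \<gamma> v))"
    by (simp only: exponent of_nat mult_single add_0 mult.assoc mult.left_commute)
qed simp

lemma diamond_eq_bilinear_extension: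
  "diamond D = bilinear_extension
     (\<lambda>\<alpha> u \<beta> v. Poly_Mapping.single 0 u * iter_deriv full_deriv \<alpha> (Poly_Mapping.single \<beta> v))"
  by (simp only: diamond_def diamond_generator)

lemma diamond_eq_op_apply: "diamond D X Y = op_apply full_deriv X Y"
proof (rule biadditive_ext[where X = X and Y = Y])
  fix \<alpha> u \<beta> v
  show "diamond D (Poly_Mapping.single \<alpha> u) (Poly_Mapping.single \<beta> v) =
        op_apply full_deriv (Poly_Mapping.single \<alpha> u) (Poly_Mapping.single \<beta> v)"
    unfolding diamond_eq_bilinear_extension
    by (subst bilinear_extension_single)
      (simp_all only: op_apply_single single_add full.iter_deriv_add distrib_left distrib_right)
qed (auto simp: diamond_eq_bilinear_extension bilinear_extension_add_left
      bilinear_extension_add_right op_apply_add_left op_apply_add_right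
      full.commuting_additive_maps_axioms full.iter_deriv_add single_add algebra_simps)

section \<open>Associativity of the composition\<close>

lemma op_apply_full_deriv:
  "op_apply full_deriv (full_deriv i W) Z = full_deriv i (op_apply full_deriv W Z)"
proof (rule additive_on_sums_ext[where X = W])
  fix \<beta> v
  show "op_apply full_deriv (full_deriv i (Poly_Mapping.single \<beta> v)) Z =
        full_deriv i (op_apply full_deriv (Poly_Mapping.single \<beta> v) Z)"
    by (simp add: full_deriv_single op_apply_add_left op_apply_single full_deriv_mult_const
        full.iter_deriv_plus_axis del: One_nat_def)
qed (simp_all add: full_deriv_add op_apply_add_left)

lemma op_apply_iter_full_deriv:
  "op_apply full_deriv (iter_deriv full_deriv \<alpha> W) Z =
   iter_deriv full_deriv \<alpha> (op_apply full_deriv W Z)"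
  by (induction \<alpha> rule: multi_index_induct)
    (simp_all add: full.iter_deriv_plus_axis op_apply_full_deriv del: One_nat_def)

lemma diamond_assoc: "diamond D X (diamond D Y Z) = diamond D (diamond D X Y) Z"
  unfolding diamond_eq_op_apply
proof (rule additive_on_sums_ext[where X = X])
  fix \<alpha> u
  show "op_apply full_deriv (Poly_Mapping.single \<alpha> u) (op_apply full_deriv Y Z) =
        op_apply full_deriv (op_apply full_deriv (Poly_Mapping.single \<alpha> u) Y) Z"
    by (simp add: op_apply_single op_apply_mult_const op_apply_iter_full_deriv)
qed (simp_all add: op_apply_add_left)

section \<open>Vector fields\<close>

lemma circ_add_left: "circ D (X + Y) Z = circ D X Z + circ D Y Z"
  by (simp add: circ_eq_op_apply op_apply_add_left)

lemma circ_vector: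
  "circ D (Poly_Mapping.single (axis i 1) u) Z = Poly_Mapping.single 0 u * coeff_deriv i Z"
  by (simp add: circ_eq_op_apply op_apply_single coeff.iter_deriv_axis del: One_nat_def)

lemma Vect_induct [consumes 1, case_names zero single add]:
  assumes "(X :: ('n, 'u) diff_op) \<in> Vect"
    and zero: "P 0"
    and single: "\<And>i u. P (Poly_Mapping.single (axis i 1) u)"
    and add: "\<And>X Y. P X \<Longrightarrow> P Y \<Longrightarrow> P (X + Y)"
  shows "P X"
proof -
  obtain u where X: "X = (\<Sum>i\<in>UNIV. Poly_Mapping.single (axis i 1) (u i))"
    using assms(1) by (auto simp: Vect_def)
  have "P (\<Sum>i\<in>S. Poly_Mapping.single (axis i 1) (u i))" if "finite S" for S
    using that by induction (auto intro: zero single add simp del: One_nat_def)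
  then show ?thesis
    by (simp add: X)
qed

text \<open>This is \<open>\<partial>\<^sub>i \<circ> (Y \<circ> Z) = (\<partial>\<^sub>i \<circ> Y) \<circ> Z + (\<partial>\<^sub>i \<bullet> Y) \<circ> Z\<close>.\<close>

lemma circ_coeff_deriv:
  "coeff_deriv i (circ D Y Z) =
   circ D (coeff_deriv i Y) Z + circ D (Poly_Mapping.single (axis i 1) 1 * Y) Z"
  unfolding circ_eq_op_apply
proof (rule additive_on_sums_ext[where X = Y])
  fix \<beta> v
  show "coeff_deriv i (op_apply coeff_deriv (Poly_Mapping.single \<beta> v) Z) =
        op_apply coeff_deriv (coeff_deriv i (Poly_Mapping.single \<beta> v)) Z +
        op_apply coeff_deriv (Poly_Mapping.single (axis i 1) 1 * Poly_Mapping.single \<beta> v) Z"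
    by (simp add: mult_single op_apply_single coeff_deriv_mult coeff.iter_deriv_plus_axis
        add.commute[of "axis i _"] del: One_nat_def)
qed (simp_all add: op_apply_add_left coeff_deriv_add distrib_left)

lemma circ_zero_left [simp]: "circ D 0 Z = 0"
  by (simp add: circ_eq_op_apply op_apply_def)

lemma circ_associator_Vect:
  assumes "X \<in> Vect"
  shows "associator (circ D) X Y Z = circ D (bullet X Y) Z"
  using assms
proof (induction X rule: Vect_induct)
  case (single i u)
  have const: "circ D (Poly_Mapping.single 0 u * W) Z = Poly_Mapping.single 0 u * circ D W Z" for W
    by (simp only: circ_eq_op_apply op_apply_mult_const)
  have "Poly_Mapping.single (axis i 1) u * Y =
        Poly_Mapping.single 0 u * (Poly_Mapping.single (axis i 1) 1 * Y)"
    by (simp add: mult.assoc[symmetric] mult_single)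
  then show ?case
    by (simp add: associator_def bullet_eq_times circ_vector circ_coeff_deriv const distrib_left
        del: One_nat_def)
qed (simp_all add: associator_def bullet_eq_times circ_add_left distrib_right algebra_simps)

lemma circ_bullet_Vect:
  assumes "X \<in> Vect"
  shows "circ D X (bullet Y Z) = bullet (circ D X Y) Z + bullet Y (circ D X Z)"
  using assms
proof (induction X rule: Vect_induct)
  case (single i u)
  show ?case
    by (simp add: bullet_eq_times circ_vector coeff_deriv_mult algebra_simps del: One_nat_def)
qed (simp_all add: bullet_eq_times circ_add_left algebra_simps)

end

section \<open>The identities\<close>

theorem proposition2:
  fixes scale :: "complex \<Rightarrow> 'u::comm_ring_1 \<Rightarrow> 'u"
    and D :: "'n::finite \<Rightarrow> 'u \<Rightarrow> 'u"
  assumes "diff_algebra scale D"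
  shows
    "(\<forall>X Y Z :: ('n, 'u) diff_op.
        diamond D X (diamond D Y Z) = diamond D (diamond D X Y) Z) \<and>
     (\<forall>X Y Z :: ('n, 'u) diff_op.
        bullet X (bullet Y Z) = bullet (bullet X Y) Z \<and> bullet X Y = bullet Y X) \<and>
     (\<forall>X \<in> Vect. \<forall>Y Z :: ('n, 'u) diff_op.
        associator (circ D) X Y Z = circ D (bullet X Y) Z \<and>
        circ D X (bullet Y Z) = bullet (circ D X Y) Z + bullet Y (circ D X Z)) \<and>
     (\<forall>X \<in> Vect. \<forall>Y \<in> Vect. \<forall>Z :: ('n, 'u) diff_op.
        associator (circ D) X Y Z = associator (circ D) Y X Z)"
proof -
  interpret diff_algebra scale D by (rule assms)
  have bullet_commute: "bullet X Y = bullet Y X" for X Y :: "('n, 'u) diff_op"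
    by (simp add: bullet_eq_times mult.commute)
  have bullet_assoc: "bullet X (bullet Y Z) = bullet (bullet X Y) Z"
    for X Y Z :: "('n, 'u) diff_op"
    by (simp add: bullet_eq_times mult.assoc)
  have "associator (circ D) X Y Z = associator (circ D) Y X Z"
    if "X \<in> Vect" "Y \<in> Vect" for X Y Z :: "('n, 'u) diff_op"
    using that by (simp add: circ_associator_Vect bullet_commute)
  then show ?thesis
    using diamond_assoc bullet_assoc bullet_commute circ_associator_Vect circ_bullet_Vect
    by blast
qed

end
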